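(* Let $d\in\{1,2\}$, $\varepsilon\ge 0$ and $T>0$. Assume that $f\in L^2(\mathbb{R}^d)$ and $\boldsymbol{U}\in C^0([0,T];\mathbb{R}^d)$. Then for every $\hat\mu_{\varepsilon,0}\in D(A_\varepsilon)$ there is a unique solution $$\hat\mu_\varepsilon\in C^0([0,T];D(A_\varepsilon))\cap C^1([0,T];L^2(\mathbb{R}^d))$$ of $$\frac{d\hat\mu_{\varepsilon}}{dt}(t)=A_\varepsilon\hat\mu_{\varepsilon}(t)-\hat g(t)\quad\text{in } L^2(\mathbb{R}^d),\ t\in[0,T],$$ such that $\hat\mu_\varepsilon(0)=\hat\mu_{\varepsilon,0}$. Moreover, $\hat\mu_\varepsilon$ is given by Duhamel's formula: for all $t\in[0,T]$ and almost every $\boldsymbol\kappa\in\mathbb{R}^d$, $$\hat\mu_{\boldsymbol\kappa,\varepsilon}(t)=\hat\mu_{\boldsymbol\kappa,\varepsilon}(0)e^{i\omega_{\boldsymbol\kappa,\varepsilon}t}-\int_0^t e^{i\omega_{\boldsymbol\kappa,\varepsilon}(t-\tau)}\hat g_{\boldsymbol\kappa}(\tau)\,d\tau .$$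
   Context: Constants: $0<\rho_1<\rho_2$ (densities), $h_1,h_2>0$ (layer thicknesses), $g>0$ (gravitational acceleration). $L^2(\mathbb{R}^d)=L^2(\mathbb{R}^d;\mathbb{C})$, and $|\cdot|_2$ is the Euclidean norm. For $\boldsymbol\kappa\in\mathbb{R}^d\setminus\{0\}$ set $$T_{j,\boldsymbol\kappa}=\rho_j\coth(2\pi|\boldsymbol\kappa|_2h_j)\ (j=1,2),\qquad \omega_{\boldsymbol\kappa}=\sqrt{\frac{2\pi|\boldsymbol\kappa|_2(\rho_2-\rho_1)g}{T_{1,\boldsymbol\kappa}+T_{2,\boldsymbol\kappa}}},\qquad \omega_{\boldsymbol\kappa,\varepsilon}=\omega_{\boldsymbol\kappa}+i\varepsilon .$$ The Fourier transform is $\hat f_{\boldsymbol\kappa}=\int_{\mathbb{R}^d}f(\boldsymbol x)e^{-2\pi i\boldsymbol\kappa\cdot\boldsymbol x}d\boldsymbol x$ (extended to $L^2$). Given the ship velocity $\boldsymbol U$, the ship position is $X(t)=\int_0^t\boldsymbol U(s)\,ds$, and the source term $\hat g(t):\boldsymbol\kappa\mapsto\hat g_{\boldsymbol\kappa}(t)$ is $$\hat g_{\boldsymbol\kappa}(t)=\frac{2\pi\rho_1\, i\,\boldsymbol\kappa\cdot\boldsymbol U(t)\,e^{-2\pi i\boldsymbol\kappa\cdot X(t)}\hat f_{\boldsymbol\kappa}}{\sinh(2\pi|\boldsymbol\kappa|_2h_1)(T_{1,\boldsymbol\kappa}+T_{2,\boldsymbol\kappa})}.$$ $A_\varepsilon$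 is the unbounded multiplication operator on $L^2(\mathbb{R}^d)$ given by $(A_\varepsilon b)_{\boldsymbol\kappa}=i\omega_{\boldsymbol\kappa,\varepsilon}b_{\boldsymbol\kappa}$ with domain $D(A_\varepsilon)=\{b\in L^2(\mathbb{R}^d): \int_{\mathbb{R}^d}(\omega_{\boldsymbol\kappa}^2+\varepsilon^2)|b_{\boldsymbol\kappa}|^2d\boldsymbol\kappa<+\infty\}$, endowed with the Hilbert norm $b\mapsto\left(\int_{\mathbb{R}^d}(1+\omega_{\boldsymbol\kappa}^2+\varepsilon^2)|b_{\boldsymbol\kappa}|^2d\boldsymbol\kappa\right)^{1/2}$. A function with values in $L^2(\mathbb{R}^d)$ is written $\hat\mu_\varepsilon(t):\boldsymbol\kappa\mapsto\hat\mu_{\boldsymbol\kappa,\varepsilon}(t)$. *)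

theory Defs
  imports "HOL-Analysis.Analysis"
begin

section \<open>The Hilbert space of square integrable functions\<close>

definition square_integrable :: "('a::euclidean_space \<Rightarrow> complex) \<Rightarrow> bool" where
  "square_integrable f \<longleftrightarrow>
     f \<in> borel_measurable lborel \<and> integrable lborel (\<lambda>x. (norm (f x))\<^sup>2)"

text \<open>Every Lebesgue measurable function agrees almost everywhere with a Borel measurable one, so
  restricting to Borel measurable representatives does not change the quotient.\<close>

definition L2_rel :: "('a::euclidean_space \<Rightarrow> complex) \<Rightarrow> ('a \<Rightarrow> complex) \<Rightarrow> bool" where
  "L2_rel f g \<longleftrightarrow> square_integrable f \<and> square_integrable g \<and> (AE x in lborel. f x = g x)"

lemma square_integrable_zero: "square_integrable (\<lambda>_. 0)"
  by (simp add: square_integrable_def)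

lemma part_equivp_L2_rel: "part_equivp L2_rel"
proof (rule part_equivpI)
  show "\<exists>f. L2_rel f f"
    using square_integrable_zero by (auto simp: L2_rel_def)
  show "symp L2_rel"
    by (auto simp: symp_def L2_rel_def)
  show "transp L2_rel"
    unfolding transp_def L2_rel_def by (auto elim: AE_mp)
qed

quotient_type (overloaded) 'a L2 = "'a::euclidean_space \<Rightarrow> complex" / partial: L2_rel
  by (rule part_equivp_L2_rel)

lemma square_integrable_add:
  assumes "square_integrable f" "square_integrable g"
  shows "square_integrable (\<lambda>x. f x + g x)"
  unfolding square_integrable_def
proof
  show meas: "(\<lambda>x. f x + g x) \<in> borel_measurable lborel"
    using assms by (auto simp: square_integrable_def intro: borel_measurable_add)
  have bound: "(norm (z + w))\<^sup>2 \<le> 2 * (norm z)\<^sup>2 + 2 * (norm w)\<^sup>2" for z w :: complex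
  proof -
    have "(norm (z + w))\<^sup>2 \<le> (norm z + norm w)\<^sup>2"
      by (simp add: norm_triangle_ineq power_mono)
    also have "\<dots> \<le> 2 * (norm z)\<^sup>2 + 2 * (norm w)\<^sup>2"
      using sum_squares_bound[of "norm z" "norm w"] by (simp add: power2_sum)
    finally show ?thesis .
  qed
  show "integrable lborel (\<lambda>x. (norm (f x + g x))\<^sup>2)"
  proof (rule Bochner_Integration.integrable_bound)
    show "integrable lborel (\<lambda>x. 2 * (norm (f x))\<^sup>2 + 2 * (norm (g x))\<^sup>2)"
      using assms by (simp add: square_integrable_def)
    show "(\<lambda>x. (norm (f x + g x))\<^sup>2) \<in> borel_measurable lborel"
      using meas by simp
    show "AE x in lborel. norm ((norm (f x + g x))\<^sup>2)
        \<le> norm (2 * (norm (f x))\<^sup>2 + 2 * (norm (g x))\<^sup>2)"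
      using bound by simp
  qed
qed

lemma square_integrable_scaleR:
  "square_integrable f \<Longrightarrow> square_integrable (\<lambda>x. c *\<^sub>R f x)"
  by (auto simp: square_integrable_def power_mult_distrib intro: borel_measurable_scaleR)

lemma square_integrable_uminus:
  "square_integrable f \<Longrightarrow> square_integrable (\<lambda>x. - f x)"
  by (simp add: square_integrable_def)

lemma square_integrable_diff:
  "square_integrable f \<Longrightarrow> square_integrable g \<Longrightarrow> square_integrable (\<lambda>x. f x - g x)"
  using square_integrable_add[OF _ square_integrable_uminus] by simp

lemma square_integrable_inner:
  assumes "square_integrable f" "square_integrable g"
  shows "integrable lborel (\<lambda>x. f x \<bullet> g x)"
proof (rule Bochner_Integration.integrable_bound)
  show "integrable lborel (\<lambda>x. (norm (f x))\<^sup>2 + (norm (g x))\<^sup>2)"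
    using assms by (simp add: square_integrable_def)
  show "(\<lambda>x. f x \<bullet> g x) \<in> borel_measurable lborel"
    using assms by (auto simp: square_integrable_def intro: borel_measurable_inner)
  have "\<bar>z \<bullet> w\<bar> \<le> (norm z)\<^sup>2 + (norm w)\<^sup>2" for z w :: complex
  proof -
    have "\<bar>z \<bullet> w\<bar> \<le> norm z * norm w"
      by (rule Cauchy_Schwarz_ineq2)
    also have "\<dots> \<le> 2 * norm z * norm w"
      by simp
    also have "\<dots> \<le> (norm z)\<^sup>2 + (norm w)\<^sup>2"
      by (rule sum_squares_bound)
    finally show ?thesis .
  qed
  then show "AE x in lborel. norm (f x \<bullet> g x) \<le> norm ((norm (f x))\<^sup>2 + (norm (g x))\<^sup>2)"
    by simp
qed

instantiation L2 :: (euclidean_space) real_vector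
begin

lift_definition zero_L2 :: "'a L2" is "\<lambda>_. 0"
  by (simp add: L2_rel_def square_integrable_zero)

lift_definition plus_L2 :: "'a L2 \<Rightarrow> 'a L2 \<Rightarrow> 'a L2" is "\<lambda>f g x. f x + g x"
  by (auto simp: L2_rel_def square_integrable_add)

lift_definition minus_L2 :: "'a L2 \<Rightarrow> 'a L2 \<Rightarrow> 'a L2" is "\<lambda>f g x. f x - g x"
  by (auto simp: L2_rel_def square_integrable_diff)

lift_definition uminus_L2 :: "'a L2 \<Rightarrow> 'a L2" is "\<lambda>f x. - f x"
  by (auto simp: L2_rel_def square_integrable_uminus)

lift_definition scaleR_L2 :: "real \<Rightarrow> 'a L2 \<Rightarrow> 'a L2" is "\<lambda>c f x. c *\<^sub>R f x"
  by (auto simp: L2_rel_def square_integrable_scaleR)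

instance
proof
  fix a b c :: "'a L2" and r s :: real
  show "a + b + c = a + (b + c)"
    by transfer (simp add: L2_rel_def square_integrable_add algebra_simps)
  show "a + b = b + a"
    by transfer (simp add: L2_rel_def square_integrable_add algebra_simps)
  show "0 + a = a"
    by transfer (simp add: L2_rel_def)
  show "- a + a = 0"
    by transfer (simp add: L2_rel_def square_integrable_zero)
  show "a - b = a + - b"
    by transfer (simp add: L2_rel_def square_integrable_diff)
  show "r *\<^sub>R (a + b) = r *\<^sub>R a + r *\<^sub>R b"
    by transfer (simp add: L2_rel_def square_integrable_add square_integrable_scaleR scaleR_add_right)
  show "(r + s) *\<^sub>R a = r *\<^sub>R a + s *\<^sub>R a"
    by transfer (simp add: L2_rel_def square_integrable_add square_integrable_scaleR scaleR_add_left)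
  show "r *\<^sub>R s *\<^sub>R a = (r * s) *\<^sub>R a"
    by transfer (simp add: L2_rel_def square_integrable_scaleR)
  show "1 *\<^sub>R a = a"
    by transfer (simp add: L2_rel_def)
qed

end

text \<open>On \<^typ>\<open>complex\<close>, the operation \<open>\<bullet>\<close> is the real part of the Hermitian product, so this is the
  real part of the usual inner product of \<open>L\<^sup>2\<close>; it induces the usual norm.\<close>

instantiation L2 :: (euclidean_space) real_inner
begin

lift_definition inner_L2 :: "'a L2 \<Rightarrow> 'a L2 \<Rightarrow> real" is "\<lambda>f g. LINT x|lborel. f x \<bullet> g x"
proof -
  fix f f' g g' :: "'a \<Rightarrow> complex"
  assume "L2_rel f f'" "L2_rel g g'"
  then show "(LINT x|lborel. f x \<bullet> g x) = (LINT x|lborel. f' x \<bullet> g' x)"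
    by (intro integral_cong_AE) (auto simp: L2_rel_def square_integrable_def)
qed

definition norm_L2 :: "'a L2 \<Rightarrow> real" where "norm_L2 f = sqrt (f \<bullet> f)"
definition sgn_L2 :: "'a L2 \<Rightarrow> 'a L2" where "sgn_L2 f = f /\<^sub>R norm f"
definition dist_L2 :: "'a L2 \<Rightarrow> 'a L2 \<Rightarrow> real" where "dist_L2 f g = norm (f - g)"
definition uniformity_L2 :: "('a L2 \<times> 'a L2) filter" where
  "uniformity_L2 = (INF e\<in>{0<..}. principal {(f, g). dist f g < e})"
definition open_L2 :: "'a L2 set \<Rightarrow> bool" where
  "open_L2 U \<longleftrightarrow> (\<forall>f\<in>U. eventually (\<lambda>(f', g). f' = f \<longrightarrow> g \<in> U) uniformity)"

instance
proof
  fix a b c :: "'a L2" and r :: real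
  show "dist a b = norm (a - b)"
    by (rule dist_L2_def)
  show "sgn a = a /\<^sub>R norm a"
    by (rule sgn_L2_def)
  show "uniformity = (INF e\<in>{0<..}. principal {(x :: 'a L2, y). dist x y < e})"
    by (rule uniformity_L2_def)
  show "open U \<longleftrightarrow> (\<forall>x\<in>U. eventually (\<lambda>(x', y). x' = x \<longrightarrow> y \<in> U) uniformity)" for U :: "'a L2 set"
    by (rule open_L2_def)
  show "a \<bullet> b = b \<bullet> a"
    by transfer (simp add: inner_commute)
  show "(a + b) \<bullet> c = a \<bullet> c + b \<bullet> c"
    by transfer (simp add: L2_rel_def inner_add_left square_integrable_inner)
  show "(r *\<^sub>R a) \<bullet> b = r * (a \<bullet> b)"
    by transfer simp
  show "0 \<le> a \<bullet> a"
    by transfer (simp add: integral_nonneg_AE)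
  show "a \<bullet> a = 0 \<longleftrightarrow> a = 0"
  proof transfer
    fix f :: "'a \<Rightarrow> complex"
    assume "L2_rel f f"
    then have f: "square_integrable f"
      by (simp add: L2_rel_def)
    have "(LINT x|lborel. f x \<bullet> f x) = 0 \<longleftrightarrow> (AE x in lborel. f x \<bullet> f x = 0)"
      by (rule integral_nonneg_eq_0_iff_AE) (auto simp: square_integrable_inner f)
    then show "(LINT x|lborel. f x \<bullet> f x) = 0 \<longleftrightarrow> L2_rel f (\<lambda>_. 0)"
      by (simp add: L2_rel_def f square_integrable_zero)
  qed
  show "norm a = sqrt (a \<bullet> a)"
    by (rule norm_L2_def)
qed

end

lemma L2_rel_rep_L2: "L2_rel (rep_L2 f) (rep_L2 f)"
  by (rule Quotient3_rep_reflp[OF Quotient3_L2])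

lemma norm_L2_eq: "norm f = sqrt (LINT x|lborel. (norm (rep_L2 f x))\<^sup>2)"
proof -
  have "f = abs_L2 (rep_L2 f)"
    by (rule Quotient3_abs_rep[OF Quotient3_L2, symmetric])
  then have "f \<bullet> f = (LINT x|lborel. rep_L2 f x \<bullet> rep_L2 f x)"
    using inner_L2.abs_eq[OF L2_rel_rep_L2 L2_rel_rep_L2] by metis
  then show ?thesis
    by (simp add: norm_L2_def power2_norm_eq_inner)
qed

section \<open>The Fourier transform\<close>

definition fourier_integral :: "('a::euclidean_space \<Rightarrow> complex) \<Rightarrow> 'a \<Rightarrow> complex" where
  "fourier_integral f \<kappa> =
     (LINT x|lborel. f x * exp (- 2 * complex_of_real pi * \<i> * complex_of_real (\<kappa> \<bullet> x)))"

text \<open>The continuous extension to \<open>L\<^sup>2\<close> of the Fourier integral on the dense subspace \<open>L\<^sup>1 \<inter> L\<^sup>2\<close>. The limit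
  exists by Plancherel's theorem, which also shows that the Fourier integral of an element of
  \<open>L\<^sup>1 \<inter> L\<^sup>2\<close> is square integrable, so that \<^const>\<open>abs_L2\<close> is only applied to square integrable functions.\<close>

definition fourier_L2 :: "'a::euclidean_space L2 \<Rightarrow> 'a L2" where
  "fourier_L2 f = Lim (at f within {u. integrable lborel (rep_L2 u)})
     (\<lambda>u. abs_L2 (fourier_integral (rep_L2 u)))"

section \<open>Dispersion relation and source term\<close>

definition coth :: "real \<Rightarrow> real" where
  "coth x = cosh x / sinh x"

text \<open>At \<open>\<kappa> = 0\<close> the following functions take the values resulting from \<open>x / 0 = 0\<close>. They only enter
  through their values almost everywhere.\<close>

definition T_layer :: "real \<Rightarrow> real \<Rightarrow> 'a::euclidean_space \<Rightarrow> real" where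
  "T_layer \<rho> h \<kappa> = \<rho> * coth (2 * pi * norm \<kappa> * h)"

definition omega :: "real \<Rightarrow> real \<Rightarrow> real \<Rightarrow> real \<Rightarrow> real \<Rightarrow> 'a::euclidean_space \<Rightarrow> real" where
  "omega \<rho>\<^sub>1 \<rho>\<^sub>2 h\<^sub>1 h\<^sub>2 g \<kappa> =
     sqrt (2 * pi * norm \<kappa> * (\<rho>\<^sub>2 - \<rho>\<^sub>1) * g / (T_layer \<rho>\<^sub>1 h\<^sub>1 \<kappa> + T_layer \<rho>\<^sub>2 h\<^sub>2 \<kappa>))"

definition omega_eps :: "('a \<Rightarrow> real) \<Rightarrow> real \<Rightarrow> 'a \<Rightarrow> complex" where
  "omega_eps \<omega> \<epsilon> \<kappa> = complex_of_real (\<omega> \<kappa>) + \<i> * complex_of_real \<epsilon>"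

definition ship_position :: "(real \<Rightarrow> 'a::euclidean_space) \<Rightarrow> real \<Rightarrow> 'a" where
  "ship_position U t = integral {0..t} U"

definition source_fun ::
  "real \<Rightarrow> real \<Rightarrow> real \<Rightarrow> real \<Rightarrow> 'a::euclidean_space L2 \<Rightarrow> (real \<Rightarrow> 'a) \<Rightarrow> real \<Rightarrow> 'a \<Rightarrow> complex" where
  "source_fun \<rho>\<^sub>1 \<rho>\<^sub>2 h\<^sub>1 h\<^sub>2 f U t \<kappa> =
     2 * complex_of_real pi * complex_of_real \<rho>\<^sub>1 * \<i> * complex_of_real (\<kappa> \<bullet> U t)
       * exp (- 2 * complex_of_real pi * \<i> * complex_of_real (\<kappa> \<bullet> ship_position U t))
       * rep_L2 (fourier_L2 f) \<kappa>
     / complex_of_real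
         (sinh (2 * pi * norm \<kappa> * h\<^sub>1) * (T_layer \<rho>\<^sub>1 h\<^sub>1 \<kappa> + T_layer \<rho>\<^sub>2 h\<^sub>2 \<kappa>))"

definition source ::
  "real \<Rightarrow> real \<Rightarrow> real \<Rightarrow> real \<Rightarrow> 'a::euclidean_space L2 \<Rightarrow> (real \<Rightarrow> 'a) \<Rightarrow> real \<Rightarrow> 'a L2" where
  "source \<rho>\<^sub>1 \<rho>\<^sub>2 h\<^sub>1 h\<^sub>2 f U t = abs_L2 (source_fun \<rho>\<^sub>1 \<rho>\<^sub>2 h\<^sub>1 h\<^sub>2 f U t)"

section \<open>The evolution equation\<close>

definition op_domain :: "('a::euclidean_space \<Rightarrow> real) \<Rightarrow> real \<Rightarrow> 'a L2 set" where
  "op_domain \<omega> \<epsilon> = {b. integrable lborel (\<lambda>\<kappa>. ((\<omega> \<kappa>)\<^sup>2 + \<epsilon>\<^sup>2) * (norm (rep_L2 b \<kappa>))\<^sup>2)}"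

definition domain_norm :: "('a::euclidean_space \<Rightarrow> real) \<Rightarrow> real \<Rightarrow> 'a L2 \<Rightarrow> real" where
  "domain_norm \<omega> \<epsilon> b =
     sqrt (LINT \<kappa>|lborel. (1 + (\<omega> \<kappa>)\<^sup>2 + \<epsilon>\<^sup>2) * (norm (rep_L2 b \<kappa>))\<^sup>2)"

text \<open>Only meaningful for arguments in \<^const>\<open>op_domain\<close>.\<close>

definition mult_op :: "('a::euclidean_space \<Rightarrow> real) \<Rightarrow> real \<Rightarrow> 'a L2 \<Rightarrow> 'a L2" where
  "mult_op \<omega> \<epsilon> b = abs_L2 (\<lambda>\<kappa>. \<i> * omega_eps \<omega> \<epsilon> \<kappa> * rep_L2 b \<kappa>)"

definition C0_domain :: "real \<Rightarrow> ('a::euclidean_space \<Rightarrow> real) \<Rightarrow> real \<Rightarrow> (real \<Rightarrow> 'a L2) set" where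
  "C0_domain T \<omega> \<epsilon> =
     {\<mu>. \<forall>t\<in>{0..T}. \<mu> t \<in> op_domain \<omega> \<epsilon> \<and>
        ((\<lambda>s. domain_norm \<omega> \<epsilon> (\<mu> s - \<mu> t)) \<longlongrightarrow> 0) (at t within {0..T})}"

definition C1_on :: "real set \<Rightarrow> (real \<Rightarrow> 'b::real_normed_vector) set" where
  "C1_on I = {\<mu>. \<exists>\<mu>'. continuous_on I \<mu>' \<and>
     (\<forall>t\<in>I. (\<mu> has_vector_derivative \<mu>' t) (at t within I))}"

definition is_solution ::
  "real \<Rightarrow> ('a::euclidean_space \<Rightarrow> real) \<Rightarrow> real \<Rightarrow> (real \<Rightarrow> 'a L2) \<Rightarrow> 'a L2 \<Rightarrow> (real \<Rightarrow> 'a L2) \<Rightarrow> bool" where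
  "is_solution T \<omega> \<epsilon> G \<mu>\<^sub>0 \<mu> \<longleftrightarrow>
     \<mu> \<in> C0_domain T \<omega> \<epsilon> \<inter> C1_on {0..T} \<and>
     (\<forall>t\<in>{0..T}. (\<mu> has_vector_derivative (mult_op \<omega> \<epsilon> (\<mu> t) - G t)) (at t within {0..T})) \<and>
     \<mu> 0 = \<mu>\<^sub>0"

end

theory Submission
  imports Defs
begin

text \<open>
  For fixed \<open>\<kappa>\<close> the equation is a scalar linear ordinary differential equation, solved by Duhamel's
  formula. Since \<open>\<epsilon> \<ge> 0\<close>, the exponentials \<open>exp (i \<omega>\<^sub>\<epsilon> t)\<close> are bounded by \<open>1\<close>, so that the solution, its time
  derivative and its product with \<open>sqrt (1 + \<omega>\<^sup>2 + \<epsilon>\<^sup>2)\<close> are dominated, uniformly in time, by one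
  square integrable function of \<open>\<kappa>\<close>: the factor \<open>1 / sinh\<close> in the source beats the growth
  \<open>\<omega>\<^sup>2 = O(|\<kappa>|)\<close>. Dominated convergence then turns pointwise continuity and differentiability in time
  into the corresponding statements in \<open>L\<^sup>2\<close> and in the domain. Uniqueness is an energy estimate: the
  difference \<open>w\<close> of two solutions satisfies
  \<open>d/dt |w|\<^sup>2 = 2 Re \<langle>w, A w\<rangle> = - 2 \<epsilon> |w|\<^sup>2 \<le> 0\<close>.
\<close>

section \<open>Square integrable functions and their classes\<close>

lemma L2_rel_rep_abs:
  assumes "square_integrable f"
  shows "L2_rel (rep_L2 (abs_L2 f)) f"
  using Quotient3_rep_abs[OF Quotient3_L2, of f] assms by (simp add: L2_rel_def)

lemma AE_rep_abs_L2:
  assumes "square_integrable f"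
  shows "AE x in lborel. rep_L2 (abs_L2 f) x = f x"
  using L2_rel_rep_abs[OF assms] by (simp add: L2_rel_def)

lemma abs_rep_L2: "abs_L2 (rep_L2 f) = f"
  by (rule Quotient3_abs_rep[OF Quotient3_L2])

lemma square_integrable_rep_L2: "square_integrable (rep_L2 f)"
  using L2_rel_rep_L2[of f] by (simp add: L2_rel_def)

lemma rep_L2_measurable [measurable]: "rep_L2 f \<in> borel_measurable borel"
  using square_integrable_rep_L2[of f] by (simp add: square_integrable_def)

lemma abs_L2_cong_AE:
  assumes "square_integrable f" "square_integrable g" "AE x in lborel. f x = g x"
  shows "abs_L2 f = abs_L2 g"
  using assms by (intro Quotient3_rel_abs[OF Quotient3_L2]) (simp add: L2_rel_def)

lemma diff_abs_L2:
  assumes "square_integrable f" "square_integrable g"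
  shows "abs_L2 f - abs_L2 g = abs_L2 (\<lambda>x. f x - g x)"
  using assms by (intro minus_L2.abs_eq) (simp_all add: L2_rel_def)

lemma scaleR_abs_L2:
  assumes "square_integrable f"
  shows "c *\<^sub>R abs_L2 f = abs_L2 (\<lambda>x. c *\<^sub>R f x)"
  using assms by (intro scaleR_L2.abs_eq) (simp_all add: L2_rel_def)

lemma norm_abs_L2:
  assumes "square_integrable f"
  shows "norm (abs_L2 f) = sqrt (LINT x|lborel. (norm (f x))\<^sup>2)"
proof -
  have "abs_L2 f \<bullet> abs_L2 f = (LINT x|lborel. f x \<bullet> f x)"
    using assms by (intro inner_L2.abs_eq) (simp_all add: L2_rel_def)
  then show ?thesis
    by (simp add: norm_eq_sqrt_inner[of "abs_L2 f"] power2_norm_eq_inner)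
qed

text \<open>\<open>rep_L2\<close> selects an arbitrary representative of each class, so it respects
  differences only up to a null set.\<close>

lemma AE_rep_L2_diff: "AE x in lborel. rep_L2 (f - g) x = rep_L2 f x - rep_L2 g x"
  using AE_rep_abs_L2[OF square_integrable_diff[OF square_integrable_rep_L2 square_integrable_rep_L2], of f g]
    diff_abs_L2[OF square_integrable_rep_L2 square_integrable_rep_L2, of f g]
  by (simp add: abs_rep_L2)

section \<open>Domination and dominated convergence for square integrals\<close>

lemma square_integrable_bound:
  assumes "f \<in> borel_measurable borel" "integrable lborel (\<lambda>x. (H x)\<^sup>2)"
    and "\<And>x. norm (f x) \<le> H x"
  shows "square_integrable f"
  unfolding square_integrable_def
proof
  show "f \<in> borel_measurable lborel" using assms(1) by simp
  show "integrable lborel (\<lambda>x. (norm (f x))\<^sup>2)"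
    using assms(3)
    by (intro Bochner_Integration.integrable_bound[OF assms(2)])
      (auto intro!: AE_I2 power_mono measurable_compose[OF assms(1)])
qed

text \<open>Dominated convergence along sequences in \<open>I - {t}\<close>, with majorant
  \<open>(H x)\<^sup>2\<close>. The bound is asked for \<open>s \<noteq> t\<close> only, which suits
  difference quotients.\<close>

lemma tendsto_integral_norm_square_zero:
  fixes \<phi> :: "'b::first_countable_topology \<Rightarrow> 'a \<Rightarrow> 'c::{banach, second_countable_topology}"
  assumes meas: "\<And>s. s \<in> I \<Longrightarrow> \<phi> s \<in> borel_measurable M"
    and int: "integrable M (\<lambda>x. (H x)\<^sup>2)"
    and bound: "\<And>s x. s \<in> I \<Longrightarrow> s \<noteq> t \<Longrightarrow> norm (\<phi> s x) \<le> H x"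
    and lim: "\<And>x. ((\<lambda>s. \<phi> s x) \<longlongrightarrow> 0) (at t within I)"
  shows "((\<lambda>s. LINT x|M. (norm (\<phi> s x))\<^sup>2) \<longlongrightarrow> 0) (at t within I)"
  unfolding tendsto_at_iff_sequentially
proof (intro allI impI)
  fix X :: "nat \<Rightarrow> 'b"
  assume X: "\<forall>i. X i \<in> I - {t}" "X \<longlonglongrightarrow> t"
  have "(\<lambda>i. LINT x|M. (norm (\<phi> (X i) x))\<^sup>2) \<longlonglongrightarrow> (LINT x|M. 0)"
  proof (rule integral_dominated_convergence[where w = "\<lambda>x. (H x)\<^sup>2"])
    show "AE x in M. (\<lambda>i. (norm (\<phi> (X i) x))\<^sup>2) \<longlonglongrightarrow> 0"
    proof (rule AE_I2)
      fix x
      have "(\<lambda>i. \<phi> (X i) x) \<longlonglongrightarrow> 0"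
        using lim[of x] X unfolding tendsto_at_iff_sequentially by (auto simp: o_def)
      from tendsto_power[OF tendsto_norm[OF this], of 2]
      show "(\<lambda>i. (norm (\<phi> (X i) x))\<^sup>2) \<longlonglongrightarrow> 0" by simp
    qed
    show "(\<lambda>x. (norm (\<phi> (X i) x))\<^sup>2) \<in> borel_measurable M" for i
      using meas[of "X i"] X by auto
    show "AE x in M. norm ((norm (\<phi> (X i) x))\<^sup>2) \<le> (H x)\<^sup>2" for i
      using bound[of "X i"] X(1) by (auto intro!: AE_I2 power_mono)
  qed (use int in auto)
  then show "((\<lambda>s. LINT x|M. (norm (\<phi> s x))\<^sup>2) \<circ> X) \<longlonglongrightarrow> 0"
    by (simp add: o_def)
qed

section \<open>Dissipativity and uniqueness\<close>

lemma norm_omega_eps_square: "(norm (omega_eps \<omega> \<epsilon> \<kappa>))\<^sup>2 = (\<omega> \<kappa>)\<^sup>2 + \<epsilon>\<^sup>2"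
  by (simp add: omega_eps_def cmod_power2)

lemma omega_eps_measurable [measurable]:
  "\<omega> \<in> borel_measurable borel \<Longrightarrow> omega_eps \<omega> \<epsilon> \<in> borel_measurable borel"
  unfolding omega_eps_def
  by (intro borel_measurable_add borel_measurable_const) measurable

lemma square_integrable_mult_op:
  assumes [measurable]: "\<omega> \<in> borel_measurable borel" and "b \<in> op_domain \<omega> \<epsilon>"
  shows "square_integrable (\<lambda>\<kappa>. \<i> * omega_eps \<omega> \<epsilon> \<kappa> * rep_L2 b \<kappa>)"
  using assms(2)
  by (simp add: square_integrable_def op_domain_def norm_mult power_mult_distrib norm_omega_eps_square)

text \<open>Membership in the domain makes both multiplied representatives square integrable, so
  \<open>abs_L2\<close> may be applied to them; their difference agrees almost everywhere with the
  multiplied representative of \<open>b - c\<close>.\<close>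

lemma op_domain_diff:
  assumes [measurable]: "\<omega> \<in> borel_measurable borel" and "b \<in> op_domain \<omega> \<epsilon>" "c \<in> op_domain \<omega> \<epsilon>"
  shows "b - c \<in> op_domain \<omega> \<epsilon>"
    and "mult_op \<omega> \<epsilon> b - mult_op \<omega> \<epsilon> c = mult_op \<omega> \<epsilon> (b - c)"
proof -
  let ?d = "\<lambda>\<kappa>. \<i> * omega_eps \<omega> \<epsilon> \<kappa> * rep_L2 b \<kappa> - \<i> * omega_eps \<omega> \<epsilon> \<kappa> * rep_L2 c \<kappa>"
  have d: "square_integrable ?d"
    using assms by (intro square_integrable_diff square_integrable_mult_op)
  have eq: "AE \<kappa> in lborel. ?d \<kappa> = \<i> * omega_eps \<omega> \<epsilon> \<kappa> * rep_L2 (b - c) \<kappa>"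
    using AE_rep_L2_diff[of b c] by eventually_elim (simp add: right_diff_distrib)
  have "integrable lborel (\<lambda>\<kappa>. (norm (\<i> * omega_eps \<omega> \<epsilon> \<kappa> * rep_L2 (b - c) \<kappa>))\<^sup>2)"
    using d unfolding square_integrable_def
    by (elim conjE, subst integrable_cong_AE[where g = "\<lambda>\<kappa>. (norm (?d \<kappa>))\<^sup>2"]) (use eq in auto)
  then show mem: "b - c \<in> op_domain \<omega> \<epsilon>"
    by (simp add: op_domain_def norm_mult power_mult_distrib norm_omega_eps_square)
  show "mult_op \<omega> \<epsilon> b - mult_op \<omega> \<epsilon> c = mult_op \<omega> \<epsilon> (b - c)"
    unfolding mult_op_def
    using assms mem d eq
    by (subst diff_abs_L2) (auto intro!: square_integrable_mult_op abs_L2_cong_AE)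
qed

text \<open>The multiplier is \<open>\<i> * \<omega> \<kappa> - \<epsilon>\<close>. As
  \<open>\<bullet>\<close> is the real part of the Hermitian product, the imaginary part of the
  multiplier drops out and only the damping remains.\<close>

lemma mult_op_dissipative:
  assumes [measurable]: "\<omega> \<in> borel_measurable borel" and "b \<in> op_domain \<omega> \<epsilon>" and "0 \<le> \<epsilon>"
  shows "b \<bullet> mult_op \<omega> \<epsilon> b \<le> 0"
proof -
  have "b \<bullet> mult_op \<omega> \<epsilon> b = abs_L2 (rep_L2 b) \<bullet> abs_L2 (\<lambda>\<kappa>. \<i> * omega_eps \<omega> \<epsilon> \<kappa> * rep_L2 b \<kappa>)"
    by (simp add: mult_op_def abs_rep_L2)
  also have "\<dots> = (LINT \<kappa>|lborel. rep_L2 b \<kappa> \<bullet> (\<i> * omega_eps \<omega> \<epsilon> \<kappa> * rep_L2 b \<kappa>))"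
    using square_integrable_mult_op[OF assms(1,2)] square_integrable_rep_L2[of b]
    by (intro inner_L2.abs_eq) (auto simp: L2_rel_def)
  also have "\<dots> = (LINT \<kappa>|lborel. - \<epsilon> * (norm (rep_L2 b \<kappa>))\<^sup>2)"
    by (intro Bochner_Integration.integral_cong refl)
      (simp add: omega_eps_def inner_complex_def cmod_power2, algebra)
  also have "\<dots> \<le> 0"
    using assms(3) by (simp add: integral_nonneg_AE)
  finally show ?thesis .
qed

text \<open>The source cancels in the difference \<open>w\<close> of two solutions, which therefore
  solves the homogeneous equation. Dissipativity keeps its squared norm from growing beyond the
  initial value 0.\<close>

lemma is_solution_unique:
  assumes "\<omega> \<in> borel_measurable borel" and "0 \<le> \<epsilon>"
    and \<mu>: "is_solution T \<omega> \<epsilon> G \<mu>\<^sub>0 \<mu>" and \<nu>: "is_solution T \<omega> \<epsilon> G \<mu>\<^sub>0 \<nu>" and t: "t \<in> {0..T}"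
  shows "\<nu> t = \<mu> t"
proof -
  define w where "w s = \<nu> s - \<mu> s" for s
  have dom: "\<nu> s \<in> op_domain \<omega> \<epsilon>" "\<mu> s \<in> op_domain \<omega> \<epsilon>" if "s \<in> {0..T}" for s
    using \<mu> \<nu> that by (auto simp: is_solution_def C0_domain_def)
  have w': "(w has_vector_derivative mult_op \<omega> \<epsilon> (w s)) (at s within {0..T})" if s: "s \<in> {0..T}" for s
  proof -
    have "(w has_vector_derivative ((mult_op \<omega> \<epsilon> (\<nu> s) - G s) - (mult_op \<omega> \<epsilon> (\<mu> s) - G s)))
        (at s within {0..T})"
      unfolding w_def using \<mu> \<nu> s by (intro has_vector_derivative_diff) (auto simp: is_solution_def)
    then show ?thesis
      using op_domain_diff(2)[OF assms(1) dom[OF s]] by (simp add: w_def)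
  qed
  \<comment> \<open>Mean value theorem for the real function \<open>w s \<bullet> w s\<close>: its
    increment is \<open>t\<close> times its derivative at some intermediate \<open>x\<close>, so the
    sign of the derivative there suffices.\<close>
  have "\<exists>x\<in>{0..t}. w t \<bullet> w t - w 0 \<bullet> w 0 = (\<lambda>h. w x \<bullet> (h *\<^sub>R mult_op \<omega> \<epsilon> (w x)) + (h *\<^sub>R mult_op \<omega> \<epsilon> (w x)) \<bullet> w x) (t - 0)"
  proof (rule mvt_very_simple)
    fix x assume "0 \<le> x" "x \<le> t"
    then have "(w has_derivative (\<lambda>h. h *\<^sub>R mult_op \<omega> \<epsilon> (w x))) (at x within {0..t})"
      using w'[of x] t unfolding has_vector_derivative_def
      by (auto intro: has_derivative_subset)
    then show "((\<lambda>s. w s \<bullet> w s) has_derivative (\<lambda>h. w x \<bullet> (h *\<^sub>R mult_op \<omega> \<epsilon> (w x)) + (h *\<^sub>R mult_op \<omega> \<epsilon> (w x)) \<bullet> w x)) (at x within {0..t})"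
      by (intro has_derivative_inner)
  qed (use t in auto)
  then obtain x where x: "x \<in> {0..t}" "w t \<bullet> w t - w 0 \<bullet> w 0 = 2 * t * (w x \<bullet> mult_op \<omega> \<epsilon> (w x))"
    by (auto simp: inner_commute)
  have "w x \<bullet> mult_op \<omega> \<epsilon> (w x) \<le> 0"
    using x t dom[of x] assms(1,2) unfolding w_def
    by (intro mult_op_dissipative op_domain_diff) auto
  then have "w t \<bullet> w t - w 0 \<bullet> w 0 \<le> 0"
    using x t by (simp add: mult_nonneg_nonpos)
  moreover have "w 0 = 0"
    using \<mu> \<nu> by (simp add: w_def is_solution_def)
  ultimately have "w t \<bullet> w t \<le> 0" by simp
  then have "w t = 0"
    using inner_ge_zero[of "w t"] by (metis antisym inner_eq_zero_iff)
  then show ?thesis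
    by (simp add: w_def)
qed

section \<open>Duhamel's formula for a diagonal evolution equation\<close>

text \<open>The source is constrained on \<open>{0..T}\<close> only, hence the indicator in the
  joint measurability assumption. The weight in \<open>G_integrable\<close> is the density of the
  domain norm: it places the integral term of Duhamel's formula in the domain.\<close>

locale diagonal_evolution =
  fixes \<omega> :: "'a::euclidean_space \<Rightarrow> real" and \<epsilon> T :: real
    and S :: "real \<Rightarrow> 'a \<Rightarrow> complex" and G :: "'a \<Rightarrow> real" and \<mu>\<^sub>0 :: "'a L2"
  assumes symbol_measurable [measurable]: "\<omega> \<in> borel_measurable borel"
    and eps_nonneg: "0 \<le> \<epsilon>" and T_nonneg: "0 \<le> T"
    and source_measurable [measurable]:
      "(\<lambda>(\<kappa>, \<tau>). indicator {0..T} \<tau> *\<^sub>R S \<tau> \<kappa>) \<in> borel_measurable (borel \<Otimes>\<^sub>M borel)"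
    and source_continuous: "continuous_on {0..T} (\<lambda>\<tau>. S \<tau> \<kappa>)"
    and source_bound: "\<tau> \<in> {0..T} \<Longrightarrow> norm (S \<tau> \<kappa>) \<le> G \<kappa>"
    and G_measurable [measurable]: "G \<in> borel_measurable borel"
    and G_integrable: "integrable lborel (\<lambda>\<kappa>. (1 + (\<omega> \<kappa>)\<^sup>2 + \<epsilon>\<^sup>2) * (G \<kappa>)\<^sup>2)"
    and initial: "\<mu>\<^sub>0 \<in> op_domain \<omega> \<epsilon>"
begin

definition symb :: "'a \<Rightarrow> complex" where
  "symb \<kappa> = \<i> * omega_eps \<omega> \<epsilon> \<kappa>"

definition duhamel :: "real \<Rightarrow> 'a \<Rightarrow> complex" where
  "duhamel t \<kappa> = rep_L2 \<mu>\<^sub>0 \<kappa> * exp (symb \<kappa> * complex_of_real t)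
     - integral {0..t} (\<lambda>\<tau>. exp (symb \<kappa> * complex_of_real (t - \<tau>)) * S \<tau> \<kappa>)"

text \<open>The right-hand side of the scalar equation at frequency \<open>\<kappa>\<close>;
  \<open>duhamel_has_derivative\<close> identifies it as the time derivative of
  \<open>duhamel\<close>.\<close>

definition rate :: "real \<Rightarrow> 'a \<Rightarrow> complex" where
  "rate t \<kappa> = symb \<kappa> * duhamel t \<kappa> - S t \<kappa>"

text \<open>The square root of the density of the domain norm; it dominates both 1 and the modulus
  of the symbol.\<close>

definition weight :: "'a \<Rightarrow> real" where
  "weight \<kappa> = sqrt (1 + (\<omega> \<kappa>)\<^sup>2 + \<epsilon>\<^sup>2)"

text \<open>A majorant for all quantities at once: \<open>T * G \<kappa>\<close> accounts for the
  time integral, the last \<open>G \<kappa>\<close> for the source itself, and the weight for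
  multiplication by the symbol.\<close>

definition dominant :: "'a \<Rightarrow> real" where
  "dominant \<kappa> = weight \<kappa> * (norm (rep_L2 \<mu>\<^sub>0 \<kappa>) + T * G \<kappa> + G \<kappa>)"

section \<open>Measurability and bounds uniform in time at fixed frequency\<close>

lemma symb_measurable [measurable]: "symb \<in> borel_measurable borel"
  unfolding symb_def by measurable

lemma weight_measurable [measurable]: "weight \<in> borel_measurable borel"
  unfolding weight_def by measurable

lemma dominant_measurable [measurable]: "dominant \<in> borel_measurable borel"
  unfolding dominant_def by measurable

lemma weight_square: "(weight \<kappa>)\<^sup>2 = 1 + (\<omega> \<kappa>)\<^sup>2 + \<epsilon>\<^sup>2"
  by (simp add: weight_def)

lemma weight_ge_1: "1 \<le> weight \<kappa>"
  by (simp add: weight_def)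

lemma norm_symb_le: "norm (symb \<kappa>) \<le> weight \<kappa>"
  unfolding weight_def symb_def norm_mult
  by (rule real_le_rsqrt) (simp add: norm_omega_eps_square)

lemma G_nonneg: "0 \<le> G \<kappa>"
  using order_trans[OF norm_ge_zero source_bound[of 0 \<kappa>]] T_nonneg by simp

text \<open>The real part of \<open>symb \<kappa>\<close> is \<open>- \<epsilon>\<close>, so the
  modulus is \<open>exp (- \<epsilon> * t)\<close>, which is at most 1 forward in time.\<close>

lemma norm_exp_symb_le:
  assumes "0 \<le> t"
  shows "norm (exp (symb \<kappa> * complex_of_real t)) \<le> 1"
  using assms eps_nonneg by (simp add: norm_exp_eq_Re symb_def omega_eps_def)

lemma dominant_integrable: "integrable lborel (\<lambda>\<kappa>. (dominant \<kappa>)\<^sup>2)"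
proof (rule Bochner_Integration.integrable_bound)
  \<comment> \<open>Obtained from (a + b)^2 \<le> 2 a^2 + 2 b^2 with b =
    \<open>(T + 1) * G \<kappa>\<close>. In the first term the squared weight is split into 1 and
    the rest, to which square integrability and domain membership of \<open>\<mu>\<^sub>0\<close>
    apply separately.\<close>
  let ?F = "\<lambda>\<kappa>. 2 * ((norm (rep_L2 \<mu>\<^sub>0 \<kappa>))\<^sup>2 + ((\<omega> \<kappa>)\<^sup>2 + \<epsilon>\<^sup>2) * (norm (rep_L2 \<mu>\<^sub>0 \<kappa>))\<^sup>2)
    + 2 * (T + 1)\<^sup>2 * ((1 + (\<omega> \<kappa>)\<^sup>2 + \<epsilon>\<^sup>2) * (G \<kappa>)\<^sup>2)"
  show "integrable lborel ?F"
    using initial square_integrable_rep_L2[of \<mu>\<^sub>0] G_integrable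
    by (intro Bochner_Integration.integrable_add integrable_mult_right)
      (auto simp: op_domain_def square_integrable_def)
  have "(dominant \<kappa>)\<^sup>2 \<le> ?F \<kappa>" for \<kappa>
  proof -
    have "(norm (rep_L2 \<mu>\<^sub>0 \<kappa>) + (T + 1) * G \<kappa>)\<^sup>2 \<le> 2 * (norm (rep_L2 \<mu>\<^sub>0 \<kappa>))\<^sup>2 + 2 * ((T + 1) * G \<kappa>)\<^sup>2"
      using sum_squares_bound[of "norm (rep_L2 \<mu>\<^sub>0 \<kappa>)" "(T + 1) * G \<kappa>"] by (simp add: power2_sum)
    then have "(weight \<kappa>)\<^sup>2 * (norm (rep_L2 \<mu>\<^sub>0 \<kappa>) + (T + 1) * G \<kappa>)\<^sup>2
        \<le> (weight \<kappa>)\<^sup>2 * (2 * (norm (rep_L2 \<mu>\<^sub>0 \<kappa>))\<^sup>2 + 2 * ((T + 1) * G \<kappa>)\<^sup>2)"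
      by (intro mult_left_mono) auto
    then show ?thesis
      unfolding dominant_def power_mult_distrib weight_square by (simp add: algebra_simps power_mult_distrib)
  qed
  then show "AE \<kappa> in lborel. norm ((dominant \<kappa>)\<^sup>2) \<le> norm (?F \<kappa>)"
    by (intro AE_I2) (auto simp only: real_norm_def abs_power2 intro: order_trans[OF _ abs_ge_self])
qed measurable

lemma source_fiber_measurable:
  assumes "t \<in> {0..T}"
  shows "S t \<in> borel_measurable borel"
proof -
  have "(\<lambda>\<kappa>. (case (\<kappa>, t) of (\<kappa>, \<tau>) \<Rightarrow> indicator {0..T} \<tau> *\<^sub>R S \<tau> \<kappa>)) \<in> borel_measurable borel"
    by (rule measurable_compose[OF _ source_measurable]) measurable
  moreover have "(\<lambda>\<kappa>. (case (\<kappa>, t) of (\<kappa>, \<tau>) \<Rightarrow> indicator {0..T} \<tau> *\<^sub>R S \<tau> \<kappa>)) = S t"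
    using assms by (simp add: fun_eq_iff)
  ultimately show ?thesis by (simp only:)
qed

lemma integrand_continuous:
  assumes "t \<in> {0..T}"
  shows "continuous_on {0..t} (\<lambda>\<tau>. exp (symb \<kappa> * complex_of_real (t - \<tau>)) * S \<tau> \<kappa>)"
  using assms by (intro continuous_intros continuous_on_subset[OF source_continuous]) auto

text \<open>Measurability in \<open>\<kappa>\<close> of a parameter integral is a Fubini-type
  statement. The integral is therefore rewritten as a Lebesgue integral with a jointly measurable
  integrand; as \<open>t \<le> T\<close>, the inner indicator does not change its value.\<close>

lemma duhamel_measurable:
  assumes "t \<in> {0..T}"
  shows "duhamel t \<in> borel_measurable borel"
proof -
  have "integral {0..t} (\<lambda>\<tau>. exp (symb \<kappa> * complex_of_real (t - \<tau>)) * S \<tau> \<kappa>)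
      = (LINT \<tau>|lborel. indicator {0..t} \<tau> *\<^sub>R (exp (symb \<kappa> * complex_of_real (t - \<tau>))
          * (indicator {0..T} \<tau> *\<^sub>R S \<tau> \<kappa>)))" for \<kappa>
  proof -
    have "integral {0..t} (\<lambda>\<tau>. exp (symb \<kappa> * complex_of_real (t - \<tau>)) * S \<tau> \<kappa>)
        = (LINT \<tau>:{0..t}|lborel. exp (symb \<kappa> * complex_of_real (t - \<tau>)) * S \<tau> \<kappa>)"
      by (rule set_borel_integral_eq_integral(2)[symmetric],
          rule borel_integrable_atLeastAtMost', rule integrand_continuous[OF assms])
    also have "\<dots> = (LINT \<tau>|lborel. indicator {0..t} \<tau> *\<^sub>R (exp (symb \<kappa> * complex_of_real (t - \<tau>))
          * (indicator {0..T} \<tau> *\<^sub>R S \<tau> \<kappa>)))"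
      unfolding set_lebesgue_integral_def using assms
      by (intro Bochner_Integration.integral_cong) (auto simp: indicator_def)
    finally show ?thesis .
  qed
  moreover have "(\<lambda>\<kappa>. LINT \<tau>|lborel. indicator {0..t} \<tau> *\<^sub>R (exp (symb \<kappa> * complex_of_real (t - \<tau>))
          * (indicator {0..T} \<tau> *\<^sub>R S \<tau> \<kappa>))) \<in> borel_measurable borel"
    by measurable
  ultimately show ?thesis
    unfolding duhamel_def by simp
qed

lemma rate_measurable:
  assumes "t \<in> {0..T}"
  shows "rate t \<in> borel_measurable borel"
  using duhamel_measurable[OF assms] source_fiber_measurable[OF assms]
  unfolding rate_def by measurable

lemma norm_duhamel_le:
  assumes t: "t \<in> {0..T}"
  shows "norm (duhamel t \<kappa>) \<le> norm (rep_L2 \<mu>\<^sub>0 \<kappa>) + T * G \<kappa>"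
proof -
  have "norm (integral {0..t} (\<lambda>\<tau>. exp (symb \<kappa> * complex_of_real (t - \<tau>)) * S \<tau> \<kappa>)) \<le> G \<kappa> * (t - 0)"
  proof (rule integral_bound)
    fix \<tau> assume \<tau>: "\<tau> \<in> {0..t}"
    show "norm (exp (symb \<kappa> * complex_of_real (t - \<tau>)) * S \<tau> \<kappa>) \<le> G \<kappa>"
      using mult_mono[OF norm_exp_symb_le[of "t - \<tau>" \<kappa>] source_bound[of \<tau> \<kappa>]] \<tau> t
      by (simp add: norm_mult)
  qed (use t integrand_continuous in auto)
  also have "\<dots> \<le> T * G \<kappa>"
    using t mult_right_mono[of t T, OF _ G_nonneg[of \<kappa>]] by (simp add: mult.commute)
  moreover have "norm (rep_L2 \<mu>\<^sub>0 \<kappa> * exp (symb \<kappa> * complex_of_real t)) \<le> norm (rep_L2 \<mu>\<^sub>0 \<kappa>)"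
    using mult_left_mono[OF norm_exp_symb_le[of t \<kappa>], of "norm (rep_L2 \<mu>\<^sub>0 \<kappa>)"] t
    by (simp add: norm_mult)
  ultimately show ?thesis
    unfolding duhamel_def by (intro order_trans[OF norm_triangle_ineq4]) linarith
qed

text \<open>The strongest pointwise bound on \<open>duhamel\<close>: since the weight dominates 1
  and the symbol, the bounds on \<open>duhamel\<close> and on its product with the symbol follow
  from it.\<close>

lemma weighted_duhamel_le:
  assumes t: "t \<in> {0..T}"
  shows "weight \<kappa> * norm (duhamel t \<kappa>) \<le> dominant \<kappa>"
  unfolding dominant_def using norm_duhamel_le[OF t, of \<kappa>] weight_ge_1[of \<kappa>] G_nonneg[of \<kappa>]
  by (intro mult_left_mono) auto

lemma norm_duhamel_le_dominant:
  assumes t: "t \<in> {0..T}"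
  shows "norm (duhamel t \<kappa>) \<le> dominant \<kappa>"
  using weighted_duhamel_le[OF t, of \<kappa>] mult_right_mono[OF weight_ge_1[of \<kappa>], of "norm (duhamel t \<kappa>)"]
  by simp

lemma norm_source_le_dominant:
  assumes t: "t \<in> {0..T}"
  shows "norm (S t \<kappa>) \<le> dominant \<kappa>"
proof -
  have "norm (S t \<kappa>) \<le> 1 * (norm (rep_L2 \<mu>\<^sub>0 \<kappa>) + T * G \<kappa> + G \<kappa>)"
    using source_bound[OF t, of \<kappa>] T_nonneg G_nonneg[of \<kappa>] by (simp add: add_increasing)
  also have "\<dots> \<le> dominant \<kappa>"
    unfolding dominant_def using T_nonneg G_nonneg[of \<kappa>] weight_ge_1 by (intro mult_right_mono) auto
  finally show ?thesis .
qed

lemma norm_symb_duhamel_le: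
  assumes t: "t \<in> {0..T}"
  shows "norm (symb \<kappa> * duhamel t \<kappa>) \<le> dominant \<kappa>"
  using weighted_duhamel_le[OF t, of \<kappa>] mult_right_mono[OF norm_symb_le[of \<kappa>], of "norm (duhamel t \<kappa>)"]
  by (simp add: norm_mult)

lemma norm_rate_le:
  assumes t: "t \<in> {0..T}"
  shows "norm (rate t \<kappa>) \<le> 2 * dominant \<kappa>"
  unfolding rate_def
  using norm_symb_duhamel_le[OF t, of \<kappa>] norm_source_le_dominant[OF t, of \<kappa>]
  by (intro order_trans[OF norm_triangle_ineq4]) simp

section \<open>The scalar equation at fixed frequency\<close>

lemma duhamel_has_derivative:
  assumes t: "t \<in> {0..T}"
  shows "((\<lambda>s. duhamel s \<kappa>) has_vector_derivative rate t \<kappa>) (at t within {0..T})"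
proof -
  let ?e = "\<lambda>s. exp (symb \<kappa> * complex_of_real s)"
  let ?J = "\<lambda>s. integral {0..s} (\<lambda>\<tau>. exp (- symb \<kappa> * complex_of_real \<tau>) * S \<tau> \<kappa>)"
  \<comment> \<open>Factoring the exponential in \<open>s\<close> out of the integral leaves
    \<open>s\<close> only as the upper limit, so the product rule and the fundamental theorem of
    calculus apply.\<close>
  have split: "duhamel s \<kappa> = ?e s * (rep_L2 \<mu>\<^sub>0 \<kappa> - ?J s)" for s
  proof -
    have "integral {0..s} (\<lambda>\<tau>. exp (symb \<kappa> * complex_of_real (s - \<tau>)) * S \<tau> \<kappa>)
        = integral {0..s} (\<lambda>\<tau>. ?e s * (exp (- symb \<kappa> * complex_of_real \<tau>) * S \<tau> \<kappa>))"
      by (intro arg_cong[where f = "integral {0..s}"] ext)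
        (simp add: right_diff_distrib exp_diff exp_minus field_simps)
    also have "\<dots> = ?e s * ?J s"
      by (rule integral_mult_right)
    finally show ?thesis
      by (simp add: duhamel_def algebra_simps)
  qed
  have e': "(?e has_vector_derivative (symb \<kappa> * ?e t)) (at t within {0..T})"
  proof -
    have "((\<lambda>z. exp (symb \<kappa> * z)) has_field_derivative (symb \<kappa> * ?e t)) (at (complex_of_real t))"
      by (auto intro!: derivative_eq_intros)
    then show ?thesis
      by (rule has_vector_derivative_at_within[OF has_vector_derivative_real_field])
  qed
  have J': "(?J has_vector_derivative (exp (- symb \<kappa> * complex_of_real t) * S t \<kappa>)) (at t within {0..T})"
    using t by (intro integral_has_vector_derivative continuous_intros source_continuous) auto
  have "((\<lambda>s. ?e s * (rep_L2 \<mu>\<^sub>0 \<kappa> - ?J s)) has_vector_derivative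
      (?e t * (0 - exp (- symb \<kappa> * complex_of_real t) * S t \<kappa>) + symb \<kappa> * ?e t * (rep_L2 \<mu>\<^sub>0 \<kappa> - ?J t)))
      (at t within {0..T})"
    by (intro has_vector_derivative_mult e' has_vector_derivative_diff J' has_vector_derivative_const)
  also have "?e t * (0 - exp (- symb \<kappa> * complex_of_real t) * S t \<kappa>) + symb \<kappa> * ?e t * (rep_L2 \<mu>\<^sub>0 \<kappa> - ?J t)
      = rate t \<kappa>"
    by (simp add: rate_def split exp_minus field_simps)
  finally show ?thesis
    by (simp add: split)
qed

lemma duhamel_continuous: "continuous_on {0..T} (\<lambda>t. duhamel t \<kappa>)"
  using has_vector_derivative_continuous[OF duhamel_has_derivative]
  by (auto simp: continuous_on_eq_continuous_within)

lemma rate_continuous: "continuous_on {0..T} (\<lambda>t. rate t \<kappa>)"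
  unfolding rate_def by (intro continuous_intros duhamel_continuous source_continuous)

lemma square_integrable_duhamel: "t \<in> {0..T} \<Longrightarrow> square_integrable (duhamel t)"
  by (rule square_integrable_bound[OF duhamel_measurable dominant_integrable norm_duhamel_le_dominant])

lemma square_integrable_source: "t \<in> {0..T} \<Longrightarrow> square_integrable (S t)"
  by (rule square_integrable_bound[OF source_fiber_measurable dominant_integrable norm_source_le_dominant])

lemma square_integrable_symb_duhamel:
  "t \<in> {0..T} \<Longrightarrow> square_integrable (\<lambda>\<kappa>. symb \<kappa> * duhamel t \<kappa>)"
  by (rule square_integrable_bound[OF _ dominant_integrable norm_symb_duhamel_le])
    (use duhamel_measurable in measurable)

lemma square_integrable_rate: "t \<in> {0..T} \<Longrightarrow> square_integrable (rate t)"
  unfolding rate_def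
  by (intro square_integrable_diff square_integrable_symb_duhamel square_integrable_source)

section \<open>Passage from the scalar equations to classes of square integrable functions\<close>

definition solution :: "real \<Rightarrow> 'a L2" where
  "solution t = abs_L2 (duhamel t)"

lemma AE_rep_solution:
  "t \<in> {0..T} \<Longrightarrow> AE \<kappa> in lborel. rep_L2 (solution t) \<kappa> = duhamel t \<kappa>"
  unfolding solution_def by (intro AE_rep_abs_L2 square_integrable_duhamel)

lemma solution_0: "solution 0 = \<mu>\<^sub>0"
proof -
  have "duhamel 0 = rep_L2 \<mu>\<^sub>0"
    by (simp add: duhamel_def fun_eq_iff)
  then show ?thesis
    by (simp add: solution_def abs_rep_L2)
qed

lemma solution_in_op_domain:
  assumes t: "t \<in> {0..T}"
  shows "solution t \<in> op_domain \<omega> \<epsilon>"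
proof -
  have "integrable lborel (\<lambda>\<kappa>. (norm (symb \<kappa> * duhamel t \<kappa>))\<^sup>2)"
    using square_integrable_symb_duhamel[OF t] by (simp add: square_integrable_def)
  then have "integrable lborel (\<lambda>\<kappa>. (norm (symb \<kappa> * rep_L2 (solution t) \<kappa>))\<^sup>2)"
    by (rule integrable_cong_AE_imp) (use AE_rep_solution[OF t] in auto)
  then show ?thesis
    by (simp add: op_domain_def norm_mult power_mult_distrib symb_def norm_omega_eps_square)
qed

text \<open>Links the operator, which acts on an arbitrary representative of the solution, to
  \<open>rate\<close>, which is built from the specific representative
  \<open>duhamel\<close>.\<close>

lemma mult_op_solution:
  assumes t: "t \<in> {0..T}"
  shows "mult_op \<omega> \<epsilon> (solution t) - abs_L2 (S t) = abs_L2 (rate t)"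
proof -
  have "mult_op \<omega> \<epsilon> (solution t) = abs_L2 (\<lambda>\<kappa>. symb \<kappa> * duhamel t \<kappa>)"
    unfolding mult_op_def
  proof (rule abs_L2_cong_AE)
    show "AE \<kappa> in lborel. \<i> * omega_eps \<omega> \<epsilon> \<kappa> * rep_L2 (solution t) \<kappa> = symb \<kappa> * duhamel t \<kappa>"
      using AE_rep_solution[OF t] by eventually_elim (simp add: symb_def)
  qed (intro square_integrable_mult_op square_integrable_symb_duhamel solution_in_op_domain
        symbol_measurable t)+
  then show ?thesis
    using diff_abs_L2[OF square_integrable_symb_duhamel[OF t] square_integrable_source[OF t]]
    by (simp add: rate_def[abs_def])
qed

text \<open>Absorbing the weight into the function gives an unweighted square integral, the form to
  which dominated convergence is applied.\<close>

lemma domain_norm_solution_diff: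
  assumes "s \<in> {0..T}" "t \<in> {0..T}"
  shows "domain_norm \<omega> \<epsilon> (solution s - solution t)
    = sqrt (LINT \<kappa>|lborel. (norm (complex_of_real (weight \<kappa>) * (duhamel s \<kappa> - duhamel t \<kappa>)))\<^sup>2)"
  unfolding domain_norm_def
proof (intro arg_cong[where f = sqrt] integral_cong_AE)
  have "AE \<kappa> in lborel. rep_L2 (solution s - solution t) \<kappa> = duhamel s \<kappa> - duhamel t \<kappa>"
    using AE_rep_L2_diff[of "solution s" "solution t"] AE_rep_solution[OF assms(1)]
      AE_rep_solution[OF assms(2)]
    by eventually_elim simp
  then show "AE \<kappa> in lborel. (1 + (\<omega> \<kappa>)\<^sup>2 + \<epsilon>\<^sup>2) * (norm (rep_L2 (solution s - solution t) \<kappa>))\<^sup>2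
      = (norm (complex_of_real (weight \<kappa>) * (duhamel s \<kappa> - duhamel t \<kappa>)))\<^sup>2"
    by eventually_elim (simp add: norm_mult power_mult_distrib weight_square)
qed (use duhamel_measurable assms in measurable)

lemma solution_C0_domain: "solution \<in> C0_domain T \<omega> \<epsilon>"
  unfolding C0_domain_def
proof (intro CollectI ballI conjI solution_in_op_domain)
  fix t assume t: "t \<in> {0..T}"
  have "((\<lambda>s. LINT \<kappa>|lborel. (norm (complex_of_real (weight \<kappa>) * (duhamel s \<kappa> - duhamel t \<kappa>)))\<^sup>2) \<longlongrightarrow> 0)
      (at t within {0..T})"
  proof (rule tendsto_integral_norm_square_zero[where H = "\<lambda>\<kappa>. 2 * dominant \<kappa>"])
    show "integrable lborel (\<lambda>\<kappa>. (2 * dominant \<kappa>)\<^sup>2)"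
      using dominant_integrable by (simp add: power_mult_distrib)
    show "((\<lambda>s. complex_of_real (weight \<kappa>) * (duhamel s \<kappa> - duhamel t \<kappa>)) \<longlongrightarrow> 0) (at t within {0..T})" for \<kappa>
      using duhamel_continuous[of \<kappa>] t unfolding continuous_on_def
      by (intro tendsto_mult_right_zero) (simp add: LIM_zero)
    show "norm (complex_of_real (weight \<kappa>) * (duhamel s \<kappa> - duhamel t \<kappa>)) \<le> 2 * dominant \<kappa>"
      if "s \<in> {0..T}" for s \<kappa>
    proof -
      have "norm (complex_of_real (weight \<kappa>) * (duhamel s \<kappa> - duhamel t \<kappa>))
          \<le> weight \<kappa> * (norm (duhamel s \<kappa>) + norm (duhamel t \<kappa>))"
        using weight_ge_1[of \<kappa>] norm_triangle_ineq4[of "duhamel s \<kappa>" "duhamel t \<kappa>"]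
        by (simp add: norm_mult)
      also have "\<dots> \<le> 2 * dominant \<kappa>"
        using weighted_duhamel_le[OF that, of \<kappa>] weighted_duhamel_le[OF t, of \<kappa>]
        by (simp add: distrib_left)
      finally show ?thesis .
    qed
  qed (use duhamel_measurable t in measurable)
  then have "((\<lambda>s. sqrt (LINT \<kappa>|lborel. (norm (complex_of_real (weight \<kappa>) * (duhamel s \<kappa> - duhamel t \<kappa>)))\<^sup>2)) \<longlongrightarrow> 0)
      (at t within {0..T})"
    using tendsto_real_sqrt by fastforce
  then show "((\<lambda>s. domain_norm \<omega> \<epsilon> (solution s - solution t)) \<longlongrightarrow> 0) (at t within {0..T})"
    \<comment> \<open>The two expressions agree on all of \<open>{0..T}\<close>, so any positive
      radius would do.\<close>
    by (rule Lim_transform_within[where d = 1]) (use domain_norm_solution_diff[OF _ t] in simp_all)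
qed

text \<open>Supplies the continuity of the derivative that \<open>C1_on\<close> demands.\<close>

lemma rate_L2_continuous: "continuous_on {0..T} (\<lambda>t. abs_L2 (rate t))"
  unfolding continuous_on_def
proof
  fix t assume t: "t \<in> {0..T}"
  have "((\<lambda>s. LINT \<kappa>|lborel. (norm (rate s \<kappa> - rate t \<kappa>))\<^sup>2) \<longlongrightarrow> 0) (at t within {0..T})"
  proof (rule tendsto_integral_norm_square_zero[where H = "\<lambda>\<kappa>. 4 * dominant \<kappa>"])
    show "integrable lborel (\<lambda>\<kappa>. (4 * dominant \<kappa>)\<^sup>2)"
      using dominant_integrable by (simp add: power_mult_distrib)
    show "((\<lambda>s. rate s \<kappa> - rate t \<kappa>) \<longlongrightarrow> 0) (at t within {0..T})" for \<kappa>
      using rate_continuous[of \<kappa>] t unfolding continuous_on_def by (simp add: LIM_zero)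
    show "norm (rate s \<kappa> - rate t \<kappa>) \<le> 4 * dominant \<kappa>" if "s \<in> {0..T}" for s \<kappa>
      using norm_rate_le[OF that, of \<kappa>] norm_rate_le[OF t, of \<kappa>]
      by (intro order_trans[OF norm_triangle_ineq4]) simp
  qed (use rate_measurable t in measurable)
  then have "((\<lambda>s. sqrt (LINT \<kappa>|lborel. (norm (rate s \<kappa> - rate t \<kappa>))\<^sup>2)) \<longlongrightarrow> 0) (at t within {0..T})"
    using tendsto_real_sqrt by fastforce
  then have "((\<lambda>s. norm (abs_L2 (rate s) - abs_L2 (rate t))) \<longlongrightarrow> 0) (at t within {0..T})"
  proof (rule Lim_transform_within[where d = 1])
    fix s assume s: "s \<in> {0..T}"
    show "sqrt (LINT \<kappa>|lborel. (norm (rate s \<kappa> - rate t \<kappa>))\<^sup>2) = norm (abs_L2 (rate s) - abs_L2 (rate t))"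
      using diff_abs_L2[OF square_integrable_rate[OF s] square_integrable_rate[OF t]]
        norm_abs_L2[OF square_integrable_diff[OF square_integrable_rate[OF s] square_integrable_rate[OF t]]]
      by simp
  qed simp
  then show "((\<lambda>t. abs_L2 (rate t)) \<longlongrightarrow> abs_L2 (rate t)) (at t within {0..T})"
    by (simp add: tendsto_norm_zero_iff LIM_zero_iff)
qed

text \<open>Dominated convergence for the normalized remainder of the first-order expansion: it
  tends to 0 at each frequency by the scalar equation, and the mean value inequality provides a
  majorant independent of \<open>s\<close>.\<close>

lemma solution_has_derivative:
  assumes t: "t \<in> {0..T}"
  shows "(solution has_vector_derivative abs_L2 (rate t)) (at t within {0..T})"
proof -
  \<comment> \<open>At \<open>s = t\<close> the factor \<open>1 / 0\<close> is 0, so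
    \<open>q t\<close> vanishes.\<close>
  define q where "q s \<kappa> = (1 / norm (s - t)) *\<^sub>R (duhamel s \<kappa> - duhamel t \<kappa> - (s - t) *\<^sub>R rate t \<kappa>)" for s \<kappa>
  have norm_q: "norm (q s \<kappa>) = norm (duhamel s \<kappa> - duhamel t \<kappa> - (s - t) *\<^sub>R rate t \<kappa>) / norm (s - t)" for s \<kappa>
    by (simp add: q_def)
  have numerator: "square_integrable (\<lambda>\<kappa>. duhamel s \<kappa> - duhamel t \<kappa> - (s - t) *\<^sub>R rate t \<kappa>)"
    if "s \<in> {0..T}" for s
    using that t
    by (intro square_integrable_diff square_integrable_scaleR square_integrable_duhamel square_integrable_rate)
  have q: "square_integrable (q s)" if "s \<in> {0..T}" for s
    unfolding q_def by (intro square_integrable_scaleR numerator that)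
  have "((\<lambda>s. LINT \<kappa>|lborel. (norm (q s \<kappa>))\<^sup>2) \<longlongrightarrow> 0) (at t within {0..T})"
  proof (rule tendsto_integral_norm_square_zero[where H = "\<lambda>\<kappa>. 4 * dominant \<kappa>"])
    show "integrable lborel (\<lambda>\<kappa>. (4 * dominant \<kappa>)\<^sup>2)"
      using dominant_integrable by (simp add: power_mult_distrib)
    show "q s \<in> borel_measurable lborel" if "s \<in> {0..T}" for s
      using q[OF that] by (simp add: square_integrable_def)
    show "((\<lambda>s. q s \<kappa>) \<longlongrightarrow> 0) (at t within {0..T})" for \<kappa>
      using duhamel_has_derivative[OF t, of \<kappa>]
      unfolding has_vector_derivative_def has_derivative_iff_norm norm_q[symmetric]
      by (simp add: tendsto_norm_zero_iff)
    show "norm (q s \<kappa>) \<le> 4 * dominant \<kappa>" if s: "s \<in> {0..T}" "s \<noteq> t" for s \<kappa>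
    proof -
      \<comment> \<open>The remainder is at most the length of the segment times the oscillation of
        \<open>rate\<close>; the constant 4 is twice the 2 from \<open>norm_rate_le\<close>.\<close>
      have "norm (duhamel s \<kappa> - duhamel t \<kappa> - (s - t) *\<^sub>R rate t \<kappa>) \<le> norm (s - t) * (4 * dominant \<kappa>)"
      proof (rule vector_differentiable_bound_linearization)
        show "((\<lambda>s. duhamel s \<kappa>) has_vector_derivative rate x \<kappa>) (at x within {0..T})"
          if "x \<in> {0..T}" for x
          by (rule duhamel_has_derivative[OF that])
        show "closed_segment t s \<subseteq> {0..T}"
          using s t by (intro closed_segment_subset) auto
        show "norm (rate x \<kappa> - rate t \<kappa>) \<le> 4 * dominant \<kappa>" if "x \<in> {0..T}" for x
          using norm_rate_le[OF that, of \<kappa>] norm_rate_le[OF t, of \<kappa>]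
          by (intro order_trans[OF norm_triangle_ineq4]) simp
      qed (fact t)
      then show ?thesis
        unfolding norm_q using s(2) by (simp add: divide_le_eq mult.commute)
    qed
  qed
  then have "((\<lambda>s. sqrt (LINT \<kappa>|lborel. (norm (q s \<kappa>))\<^sup>2)) \<longlongrightarrow> 0) (at t within {0..T})"
    using tendsto_real_sqrt by fastforce
  then have "((\<lambda>s. norm (solution s - solution t - (s - t) *\<^sub>R abs_L2 (rate t)) / norm (s - t)) \<longlongrightarrow> 0)
      (at t within {0..T})"
  proof (rule Lim_transform_within[where d = 1])
    fix s assume s: "s \<in> {0..T}"
    have "norm (solution s - solution t - (s - t) *\<^sub>R abs_L2 (rate t)) / norm (s - t)
        = norm ((1 / norm (s - t)) *\<^sub>R (solution s - solution t - (s - t) *\<^sub>R abs_L2 (rate t)))"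
      by simp
    also have "\<dots> = norm (abs_L2 (q s))"
      unfolding q_def solution_def
      by (simp only: diff_abs_L2 scaleR_abs_L2 square_integrable_diff square_integrable_scaleR
          square_integrable_duhamel square_integrable_rate s t numerator)
    finally show "sqrt (LINT \<kappa>|lborel. (norm (q s \<kappa>))\<^sup>2)
        = norm (solution s - solution t - (s - t) *\<^sub>R abs_L2 (rate t)) / norm (s - t)"
      using norm_abs_L2[OF q[OF s]] by simp
  qed simp
  then show ?thesis
    unfolding has_vector_derivative_def has_derivative_iff_norm
    by (simp add: bounded_linear_scaleR_left)
qed

theorem solution_is_solution: "is_solution T \<omega> \<epsilon> (\<lambda>t. abs_L2 (S t)) \<mu>\<^sub>0 solution"
  unfolding is_solution_def C1_on_def
  using solution_C0_domain solution_has_derivative rate_L2_continuous solution_0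
  by (auto simp: mult_op_solution)

end

section \<open>Bounds on the dispersion relation and on the source\<close>

lemma cosh_ge_quadratic:
  fixes x :: real
  assumes "0 \<le> x"
  shows "1 + x\<^sup>2 / 4 \<le> cosh x"
  \<comment> \<open>Averaging exp x \<ge> 1 + x + x^2/2 and exp (-x) \<ge> 1 - x cancels the linear
    terms.\<close>
  using exp_lower_Taylor_quadratic[OF assms] exp_ge_add_one_self[of "- x"]
  by (simp add: cosh_def field_simps)

lemma le_cosh_real:
  fixes x :: real
  assumes "0 \<le> x"
  shows "x \<le> cosh x"
  using cosh_ge_quadratic[OF assms] zero_le_power2[of "1 - x / 2"] by (simp add: power2_diff field_simps)

text \<open>The product of x \<le> cosh x and x^2 \<le> 4 cosh x. The third power arises later as
  the linear growth of the squared frequency times the squared factor \<open>norm \<kappa>\<close>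
  of the source.\<close>

lemma cube_le_cosh_square:
  fixes x :: real
  assumes "0 \<le> x"
  shows "x ^ 3 \<le> 4 * (cosh x)\<^sup>2"
proof -
  have "x\<^sup>2 \<le> 4 * cosh x"
    using cosh_ge_quadratic[OF assms] by simp
  then have "x * x\<^sup>2 \<le> cosh x * (4 * cosh x)"
    using assms le_cosh_real[OF assms] by (intro mult_mono) auto
  then show ?thesis
    by (simp add: power2_eq_square power3_eq_cube algebra_simps)
qed

section \<open>Estimates for the layers, the frequency and the source\<close>

lemma T_layer_ge:
  assumes "0 < \<rho>" "0 < h" "\<kappa> \<noteq> 0"
  shows "\<rho> \<le> T_layer \<rho> h \<kappa>"
proof -
  have "0 < 2 * pi * norm \<kappa> * h"
    using assms by simp
  \<comment> \<open>This fails at \<open>\<kappa> = 0\<close>, where division by zero makes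
    \<open>coth\<close> equal to 0.\<close>
  then have "1 \<le> coth (2 * pi * norm \<kappa> * h)"
    unfolding coth_def by (subst le_divide_eq) (auto simp: sinh_le_cosh_real)
  then show ?thesis
    using assms(1) by (simp add: T_layer_def)
qed

text \<open>The factor sinh cancels the denominator of the first layer's coth, and the second layer
  contributes a nonnegative term. Thus the apparent singularity of the source at low frequency
  disappears.\<close>

lemma cosh_le_sinh_mult_T_layer:
  assumes "0 < \<rho>\<^sub>1" "0 < \<rho>\<^sub>2" "0 < h\<^sub>1" "0 < h\<^sub>2" "\<kappa> \<noteq> 0"
  shows "\<rho>\<^sub>1 * cosh (2 * pi * norm \<kappa> * h\<^sub>1)
    \<le> sinh (2 * pi * norm \<kappa> * h\<^sub>1) * (T_layer \<rho>\<^sub>1 h\<^sub>1 \<kappa> + T_layer \<rho>\<^sub>2 h\<^sub>2 \<kappa>)"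
proof -
  have "0 < sinh (2 * pi * norm \<kappa> * h\<^sub>1)"
    using assms by simp
  moreover from this have "sinh (2 * pi * norm \<kappa> * h\<^sub>1) * T_layer \<rho>\<^sub>1 h\<^sub>1 \<kappa> = \<rho>\<^sub>1 * cosh (2 * pi * norm \<kappa> * h\<^sub>1)"
    using assms by (simp add: T_layer_def coth_def)
  moreover have "0 \<le> T_layer \<rho>\<^sub>2 h\<^sub>2 \<kappa>"
    using T_layer_ge[of \<rho>\<^sub>2 h\<^sub>2 \<kappa>] assms by simp
  ultimately show ?thesis
    by (simp add: distrib_left)
qed

text \<open>For nonzero \<open>\<kappa>\<close> the denominator is at least
  \<open>\<rho>\<^sub>1\<close>, which leaves linear growth in \<open>norm \<kappa>\<close>; at
  \<open>\<kappa> = 0\<close> both sides vanish.\<close>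

lemma omega_square_le:
  assumes "0 < \<rho>\<^sub>1" "\<rho>\<^sub>1 < \<rho>\<^sub>2" "0 < h\<^sub>1" "0 < h\<^sub>2" "0 < g"
  shows "(omega \<rho>\<^sub>1 \<rho>\<^sub>2 h\<^sub>1 h\<^sub>2 g \<kappa>)\<^sup>2 \<le> 2 * pi * (\<rho>\<^sub>2 - \<rho>\<^sub>1) * g / \<rho>\<^sub>1 * norm \<kappa>"
proof (cases "\<kappa> = 0")
  case False
  let ?n = "2 * pi * norm \<kappa> * (\<rho>\<^sub>2 - \<rho>\<^sub>1) * g"
  have T: "\<rho>\<^sub>1 \<le> T_layer \<rho>\<^sub>1 h\<^sub>1 \<kappa> + T_layer \<rho>\<^sub>2 h\<^sub>2 \<kappa>"
    using T_layer_ge[of \<rho>\<^sub>1 h\<^sub>1 \<kappa>] T_layer_ge[of \<rho>\<^sub>2 h\<^sub>2 \<kappa>] assms False by simp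
  have n: "0 \<le> ?n"
    using assms by simp
  have "(omega \<rho>\<^sub>1 \<rho>\<^sub>2 h\<^sub>1 h\<^sub>2 g \<kappa>)\<^sup>2 = ?n / (T_layer \<rho>\<^sub>1 h\<^sub>1 \<kappa> + T_layer \<rho>\<^sub>2 h\<^sub>2 \<kappa>)"
    unfolding omega_def using n T assms by (intro real_sqrt_pow2 divide_nonneg_nonneg) auto
  also have "\<dots> \<le> ?n / \<rho>\<^sub>1"
    using n T assms by (intro divide_left_mono) auto
  finally show ?thesis
    by (simp add: ac_simps)
qed (simp add: omega_def)

text \<open>The phase has modulus 1, Cauchy-Schwarz controls \<open>\<kappa> \<bullet> U t\<close>,
  and the factor \<open>\<rho>\<^sub>1\<close> of the numerator cancels against the lower bound for
  the denominator.\<close>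

lemma norm_source_fun_le:
  assumes "0 < \<rho>\<^sub>1" "0 < \<rho>\<^sub>2" "0 < h\<^sub>1" "0 < h\<^sub>2" "norm (U t) \<le> B"
  shows "norm (source_fun \<rho>\<^sub>1 \<rho>\<^sub>2 h\<^sub>1 h\<^sub>2 f U t \<kappa>)
    \<le> 2 * pi * B * (norm \<kappa> / cosh (2 * pi * norm \<kappa> * h\<^sub>1)) * norm (rep_L2 (fourier_L2 f) \<kappa>)"
proof (cases "\<kappa> = 0")
  case False
  let ?D = "sinh (2 * pi * norm \<kappa> * h\<^sub>1) * (T_layer \<rho>\<^sub>1 h\<^sub>1 \<kappa> + T_layer \<rho>\<^sub>2 h\<^sub>2 \<kappa>)"
  let ?c = "cosh (2 * pi * norm \<kappa> * h\<^sub>1)" and ?F = "norm (rep_L2 (fourier_L2 f) \<kappa>)"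
  have D: "\<rho>\<^sub>1 * ?c \<le> ?D"
    using assms False by (intro cosh_le_sinh_mult_T_layer)
  have pos: "0 < \<rho>\<^sub>1 * ?c"
    using assms by simp
  have B: "0 \<le> B"
    using order_trans[OF norm_ge_zero assms(5)] .
  have "\<bar>\<kappa> \<bullet> U t\<bar> \<le> norm \<kappa> * B"
    using Cauchy_Schwarz_ineq2[of \<kappa> "U t"] mult_left_mono[OF assms(5), of "norm \<kappa>"] by simp
  then have num: "2 * pi * \<rho>\<^sub>1 * \<bar>\<kappa> \<bullet> U t\<bar> * ?F \<le> 2 * pi * \<rho>\<^sub>1 * (norm \<kappa> * B) * ?F"
    using assms by (intro mult_left_mono mult_right_mono) auto
  have "norm (source_fun \<rho>\<^sub>1 \<rho>\<^sub>2 h\<^sub>1 h\<^sub>2 f U t \<kappa>) = 2 * pi * \<rho>\<^sub>1 * \<bar>\<kappa> \<bullet> U t\<bar> * ?F / \<bar>?D\<bar>"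
    unfolding source_fun_def norm_mult norm_divide norm_of_real norm_exp_eq_Re
    using assms by simp
  also have "\<dots> \<le> 2 * pi * \<rho>\<^sub>1 * (norm \<kappa> * B) * ?F / (\<rho>\<^sub>1 * ?c)"
    using D pos num assms B by (intro frac_le) auto
  also have "\<dots> = 2 * pi * B * (norm \<kappa> / ?c) * ?F"
    using assms by simp
  finally show ?thesis .
qed (simp add: source_fun_def)

section \<open>Measurability and continuity of the data\<close>

lemma cosh_measurable [measurable]: "(cosh :: real \<Rightarrow> real) \<in> borel_measurable borel"
  by (intro borel_measurable_continuous_onI continuous_intros)

lemma sinh_measurable [measurable]: "(sinh :: real \<Rightarrow> real) \<in> borel_measurable borel"
  by (intro borel_measurable_continuous_onI continuous_intros)

lemma T_layer_measurable [measurable]: "T_layer \<rho> h \<in> borel_measurable borel"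
  unfolding T_layer_def coth_def by measurable

lemma omega_measurable [measurable]: "omega \<rho>\<^sub>1 \<rho>\<^sub>2 h\<^sub>1 h\<^sub>2 g \<in> borel_measurable borel"
  unfolding omega_def by measurable

lemma ship_position_continuous:
  "continuous_on {0..T} U \<Longrightarrow> continuous_on {0..T} (ship_position U)"
  unfolding ship_position_def by (intro indefinite_integral_continuous_1 integrable_continuous_real)

lemma source_fun_continuous:
  assumes "continuous_on {0..T} U"
  shows "continuous_on {0..T} (\<lambda>t. source_fun \<rho>\<^sub>1 \<rho>\<^sub>2 h\<^sub>1 h\<^sub>2 f U t \<kappa>)"
  \<comment> \<open>The denominator is constant in time, so as an inverse it is a constant factor,
    even at \<open>\<kappa> = 0\<close>.\<close>
  unfolding source_fun_def divide_inverse
  by (intro continuous_intros assms ship_position_continuous)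

lemma source_fun_measurable:
  assumes "continuous_on {0..T} U"
  shows "(\<lambda>(\<kappa>, t). indicator {0..T} t *\<^sub>R source_fun \<rho>\<^sub>1 \<rho>\<^sub>2 h\<^sub>1 h\<^sub>2 f U t \<kappa>)
    \<in> borel_measurable (borel \<Otimes>\<^sub>M borel)"
proof -
  \<comment> \<open>Velocity and position are known to be continuous on \<open>{0..T}\<close> only;
    cutting them off there makes them Borel on the whole line.\<close>
  define V where "V t = indicator {0..T} t *\<^sub>R U t" for t
  define X where "X t = indicator {0..T} t *\<^sub>R ship_position U t" for t
  have [measurable]: "V \<in> borel_measurable borel" "X \<in> borel_measurable borel"
    unfolding V_def X_def
    by (intro borel_measurable_continuous_on_indicator assms ship_position_continuous; simp)+
  \<comment> \<open>Outside \<open>{0..T}\<close> the factor \<open>\<kappa> \<bullet> V t\<close>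
    is 0, which takes over the role of the outer indicator.\<close>
  have "(\<lambda>(\<kappa>, t). indicator {0..T} t *\<^sub>R source_fun \<rho>\<^sub>1 \<rho>\<^sub>2 h\<^sub>1 h\<^sub>2 f U t \<kappa>)
    = (\<lambda>(\<kappa>, t). 2 * complex_of_real pi * complex_of_real \<rho>\<^sub>1 * \<i> * complex_of_real (\<kappa> \<bullet> V t)
       * exp (- 2 * complex_of_real pi * \<i> * complex_of_real (\<kappa> \<bullet> X t))
       * rep_L2 (fourier_L2 f) \<kappa>
     / complex_of_real
         (sinh (2 * pi * norm \<kappa> * h\<^sub>1) * (T_layer \<rho>\<^sub>1 h\<^sub>1 \<kappa> + T_layer \<rho>\<^sub>2 h\<^sub>2 \<kappa>)))"
    by (auto simp: fun_eq_iff source_fun_def V_def X_def indicator_def)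
  also have "\<dots> \<in> borel_measurable (borel \<Otimes>\<^sub>M borel)"
    by measurable
  finally show ?thesis .
qed

lemma source_majorant_integrable:
  fixes F :: "'a::euclidean_space \<Rightarrow> complex"
  assumes [measurable]: "\<omega> \<in> borel_measurable borel" and F: "square_integrable F"
    and "0 < a" "0 \<le> c" and \<omega>: "\<And>\<kappa>. (\<omega> \<kappa>)\<^sup>2 \<le> c * norm \<kappa>"
  shows "integrable lborel
    (\<lambda>\<kappa>. (1 + (\<omega> \<kappa>)\<^sup>2 + \<epsilon>\<^sup>2) * (B * (norm \<kappa> / cosh (a * norm \<kappa>)) * norm (F \<kappa>))\<^sup>2)"
proof (rule Bochner_Integration.integrable_bound)
  \<comment> \<open>A bound for the weighted squared multiplier of \<open>F\<close>: with r =
    \<open>norm \<kappa>\<close>, the part \<open>1 + \<epsilon>\<^sup>2\<close> uses a r \<le> cosh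
    (a r), and the part with the squared frequency uses (a r)^3 \<le> 4 (cosh (a r))^2.\<close>
  let ?K = "((1 + \<epsilon>\<^sup>2) / a\<^sup>2 + 4 * c / a ^ 3) * B\<^sup>2"
  show "integrable lborel (\<lambda>\<kappa>. ?K * (norm (F \<kappa>))\<^sup>2)"
    using F by (simp add: square_integrable_def)
  have [measurable]: "F \<in> borel_measurable borel"
    using F by (simp add: square_integrable_def)
  show "(\<lambda>\<kappa>. (1 + (\<omega> \<kappa>)\<^sup>2 + \<epsilon>\<^sup>2) * (B * (norm \<kappa> / cosh (a * norm \<kappa>)) * norm (F \<kappa>))\<^sup>2)
      \<in> borel_measurable lborel"
    by measurable
  have bound: "(1 + (\<omega> \<kappa>)\<^sup>2 + \<epsilon>\<^sup>2) * (norm \<kappa> / cosh (a * norm \<kappa>))\<^sup>2 \<le> (1 + \<epsilon>\<^sup>2) / a\<^sup>2 + 4 * c / a ^ 3" for \<kappa>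
  proof -
    define r where "r = norm \<kappa>"
    define C where "C = cosh (a * r)"
    have r: "0 \<le> r" and C: "0 < C"
      by (simp_all add: r_def C_def)
    have "a * r \<le> C"
      unfolding C_def using r assms(3) by (intro le_cosh_real) simp
    then have "(a * r)\<^sup>2 \<le> C\<^sup>2"
      using r assms(3) by (intro power_mono) auto
    then have 1: "r\<^sup>2 / C\<^sup>2 \<le> 1 / a\<^sup>2"
      using C assms(3) by (simp add: field_simps)
    have "(a * r) ^ 3 \<le> 4 * C\<^sup>2"
      unfolding C_def using r assms(3) by (intro cube_le_cosh_square) simp
    then have 2: "r ^ 3 / C\<^sup>2 \<le> 4 / a ^ 3"
      using C assms(3) by (simp add: field_simps)
    have "(1 + (\<omega> \<kappa>)\<^sup>2 + \<epsilon>\<^sup>2) * (r / C)\<^sup>2 \<le> (1 + c * r + \<epsilon>\<^sup>2) * (r / C)\<^sup>2"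
      using \<omega>[of \<kappa>] by (intro mult_right_mono) (auto simp: r_def)
    also have "\<dots> = (1 + \<epsilon>\<^sup>2) * (r\<^sup>2 / C\<^sup>2) + c * (r ^ 3 / C\<^sup>2)"
      by (simp add: power_divide power2_eq_square power3_eq_cube add_divide_distrib distrib_right)
    also have "\<dots> \<le> (1 + \<epsilon>\<^sup>2) * (1 / a\<^sup>2) + c * (4 / a ^ 3)"
      using 1 2 assms(4) by (intro add_mono mult_left_mono) auto
    finally show ?thesis
      by (simp add: r_def C_def mult.commute)
  qed
  show "AE \<kappa> in lborel. norm ((1 + (\<omega> \<kappa>)\<^sup>2 + \<epsilon>\<^sup>2) * (B * (norm \<kappa> / cosh (a * norm \<kappa>)) * norm (F \<kappa>))\<^sup>2)
      \<le> norm (?K * (norm (F \<kappa>))\<^sup>2)"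
  proof (rule AE_I2)
    fix \<kappa> :: 'a
    have "norm ((1 + (\<omega> \<kappa>)\<^sup>2 + \<epsilon>\<^sup>2) * (B * (norm \<kappa> / cosh (a * norm \<kappa>)) * norm (F \<kappa>))\<^sup>2)
        = (1 + (\<omega> \<kappa>)\<^sup>2 + \<epsilon>\<^sup>2) * (norm \<kappa> / cosh (a * norm \<kappa>))\<^sup>2 * (B\<^sup>2 * (norm (F \<kappa>))\<^sup>2)"
      unfolding real_norm_def
      by (subst abs_of_nonneg) (simp_all add: power_mult_distrib power_divide)
    also have "\<dots> \<le> ((1 + \<epsilon>\<^sup>2) / a\<^sup>2 + 4 * c / a ^ 3) * (B\<^sup>2 * (norm (F \<kappa>))\<^sup>2)"
      by (intro mult_right_mono bound) simp
    also have "\<dots> \<le> norm (?K * (norm (F \<kappa>))\<^sup>2)"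
      unfolding real_norm_def by (simp only: mult.assoc abs_ge_self)
    finally show "norm ((1 + (\<omega> \<kappa>)\<^sup>2 + \<epsilon>\<^sup>2) * (B * (norm \<kappa> / cosh (a * norm \<kappa>)) * norm (F \<kappa>))\<^sup>2)
      \<le> norm (?K * (norm (F \<kappa>))\<^sup>2)" .
  qed
qed

section \<open>The two-layer problem as a diagonal evolution equation\<close>

theorem theorem10:
  fixes \<rho>\<^sub>1 \<rho>\<^sub>2 h\<^sub>1 h\<^sub>2 g \<epsilon> T :: real
    and f \<mu>\<^sub>0 :: "(real ^ 'd) L2"
    and U :: "real \<Rightarrow> real ^ 'd"
  assumes "CARD('d) \<in> {1, 2}"
    and "0 < \<rho>\<^sub>1" "\<rho>\<^sub>1 < \<rho>\<^sub>2" "0 < h\<^sub>1" "0 < h\<^sub>2" "0 < g"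
    and "0 \<le> \<epsilon>" "0 < T"
    and "continuous_on {0..T} U"
    and "\<mu>\<^sub>0 \<in> op_domain (omega \<rho>\<^sub>1 \<rho>\<^sub>2 h\<^sub>1 h\<^sub>2 g) \<epsilon>"
  shows "\<exists>\<mu>. is_solution T (omega \<rho>\<^sub>1 \<rho>\<^sub>2 h\<^sub>1 h\<^sub>2 g) \<epsilon> (source \<rho>\<^sub>1 \<rho>\<^sub>2 h\<^sub>1 h\<^sub>2 f U) \<mu>\<^sub>0 \<mu> \<and>
    (\<forall>\<nu>. is_solution T (omega \<rho>\<^sub>1 \<rho>\<^sub>2 h\<^sub>1 h\<^sub>2 g) \<epsilon> (source \<rho>\<^sub>1 \<rho>\<^sub>2 h\<^sub>1 h\<^sub>2 f U) \<mu>\<^sub>0 \<nu>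
       \<longrightarrow> (\<forall>t\<in>{0..T}. \<nu> t = \<mu> t)) \<and>
    (\<forall>t\<in>{0..T}. AE \<kappa> in lborel.
       rep_L2 (\<mu> t) \<kappa> =
         rep_L2 (\<mu> 0) \<kappa> * exp (\<i> * omega_eps (omega \<rho>\<^sub>1 \<rho>\<^sub>2 h\<^sub>1 h\<^sub>2 g) \<epsilon> \<kappa> * complex_of_real t)
         - integral {0..t} (\<lambda>\<tau>. exp (\<i> * omega_eps (omega \<rho>\<^sub>1 \<rho>\<^sub>2 h\<^sub>1 h\<^sub>2 g) \<epsilon> \<kappa> * complex_of_real (t - \<tau>))
             * source_fun \<rho>\<^sub>1 \<rho>\<^sub>2 h\<^sub>1 h\<^sub>2 f U \<tau> \<kappa>))"
proof -
  let ?\<omega> = "omega \<rho>\<^sub>1 \<rho>\<^sub>2 h\<^sub>1 h\<^sub>2 g :: real ^ 'd \<Rightarrow> real"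
  let ?S = "source_fun \<rho>\<^sub>1 \<rho>\<^sub>2 h\<^sub>1 h\<^sub>2 f U"
  \<comment> \<open>Compactness of \<open>{0..T}\<close> yields one speed bound for all times, hence
    a majorant \<open>G\<close> independent of time.\<close>
  have "bounded (U ` {0..T})"
    using assms by (intro compact_imp_bounded compact_continuous_image) auto
  then obtain B where B: "norm (U t) \<le> B" if "t \<in> {0..T}" for t
    unfolding bounded_iff by blast
  define G where "G \<kappa> = 2 * pi * B * (norm \<kappa> / cosh (2 * pi * norm \<kappa> * h\<^sub>1)) * norm (rep_L2 (fourier_L2 f) \<kappa>)"
    for \<kappa> :: "real ^ 'd"
  interpret diagonal_evolution ?\<omega> \<epsilon> T ?S G \<mu>\<^sub>0
  proof
    show "norm (?S \<tau> \<kappa>) \<le> G \<kappa>" if "\<tau> \<in> {0..T}" for \<tau> \<kappa>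
      unfolding G_def using assms B[OF that] by (intro norm_source_fun_le) auto
    show "G \<in> borel_measurable borel"
      unfolding G_def by measurable
    \<comment> \<open>The majorant lemma is used with \<open>a = 2 * pi * h\<^sub>1\<close>; the
      argument of cosh is reordered to fit the form \<open>a * norm \<kappa>\<close>.\<close>
    have "integrable lborel (\<lambda>\<kappa>. (1 + (?\<omega> \<kappa>)\<^sup>2 + \<epsilon>\<^sup>2)
        * (2 * pi * B * (norm \<kappa> / cosh (2 * pi * h\<^sub>1 * norm \<kappa>)) * norm (rep_L2 (fourier_L2 f) \<kappa>))\<^sup>2)"
      using assms
      by (intro source_majorant_integrable[where c = "2 * pi * (\<rho>\<^sub>2 - \<rho>\<^sub>1) * g / \<rho>\<^sub>1"]
          omega_measurable omega_square_le square_integrable_rep_L2) auto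
    then show "integrable lborel (\<lambda>\<kappa>. (1 + (?\<omega> \<kappa>)\<^sup>2 + \<epsilon>\<^sup>2) * (G \<kappa>)\<^sup>2)"
      by (simp add: G_def mult.commute mult.left_commute)
  qed (use assms in \<open>auto intro: omega_measurable source_fun_measurable source_fun_continuous\<close>)
  have sol: "is_solution T ?\<omega> \<epsilon> (source \<rho>\<^sub>1 \<rho>\<^sub>2 h\<^sub>1 h\<^sub>2 f U) \<mu>\<^sub>0 solution"
    using solution_is_solution unfolding source_def[abs_def] .
  show ?thesis
  proof (intro exI[of _ solution] conjI allI impI ballI sol)
    fix \<nu> t
    assume "is_solution T ?\<omega> \<epsilon> (source \<rho>\<^sub>1 \<rho>\<^sub>2 h\<^sub>1 h\<^sub>2 f U) \<mu>\<^sub>0 \<nu>" "t \<in> {0..T}"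
    with sol assms(7) show "\<nu> t = solution t"
      by (intro is_solution_unique[OF omega_measurable]) auto
  next
    fix t assume "t \<in> {0..T}"
    then show "AE \<kappa> in lborel. rep_L2 (solution t) \<kappa> =
         rep_L2 (solution 0) \<kappa> * exp (\<i> * omega_eps ?\<omega> \<epsilon> \<kappa> * complex_of_real t)
         - integral {0..t} (\<lambda>\<tau>. exp (\<i> * omega_eps ?\<omega> \<epsilon> \<kappa> * complex_of_real (t - \<tau>)) * ?S \<tau> \<kappa>)"
      \<comment> \<open>Since \<open>solution 0 = \<mu>\<^sub>0\<close>, the initial representative
        is exactly the one inside \<open>duhamel\<close>; the null set stems from the representative
        at time \<open>t\<close>.\<close>
      using AE_rep_solution[of t] by (simp add: solution_0 duhamel_def symb_def)
  qed
qed

end
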